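(* Let $p\in(0,1)$ and let $\mathbf h=(h_1,h_2)\ne(0,0)$ be a pair of non-negative integers. For all integers $m,n\ge 0$ and every integer $k\ge 0$, $$\mathbb{P}\big(\mathcal{L}^{\mathbf h}_{(m,n)}\le k\big)=\mathbb{P}\big(T_{(m-h_1k,\;n-h_2k)}\le k\big).$$
   Context: Let $\Xi=(\Xi_{i,j})_{i,j\ge 1}$ be i.i.d. Bernoulli random variables with mean $p$, identified with the random set of $(i,j)\in(\mathbb{Z}_{>0})^2$ such that $\Xi_{i,j}=1$. For a pair of non-negative integers $\mathbf h=(h_1,h_2)\neq(0,0)$, write $(i,j)\stackrel{\mathbf h}{\prec}(i',j')$ if $i+h_1\le i'$ and $j+h_2\le j'$. $\mathcal{L}^{\mathbf h}_{(m,n)}$ is the maximal integer $L\ge 0$ such that there are points $(i_1,j_1),\dots,(i_L,j_L)\in\Xi$ with $1\le i_1\le\dots\le i_L\le m$, $1\le j_1\le\dots\le j_L\le n$ and $(i_1,j_1)\stackrel{\mathbf h}{\prec}(i_2,j_2)\stackrel{\mathbf h}{\prec}\dots\stackrel{\mathbf h}{\prec}(i_L,j_L)$ (so it equals $0$ if $m\le 0$ or $n\le 0$). Last-passage percolation with geometric weights: let $(\Xi'_{i,j})_{i,j\ge 1}$ be i.i.d. with $\mathbb{P}(\Xi'_{i,j}=k)=p^k(1-p)$ for integers $k\ge 0$. For $m,n\ge 1$, $T_{(m,n)}=\max\{\sum_{(i,j)\in P}\Xi'_{i,j}: P\in\mathcal{P}_{m,n}\}$, where $\mathcal{P}_{m,n}$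 is the set of lattice paths from $(1,1)$ to $(m,n)$ taking only unit North and East steps. By convention $T_{(m,n)}=0$ if $m\le 0$ or $n\le 0$. *)

theory Defs
  imports "HOL-Probability.Probability"
begin

definition sites :: "(nat \<times> nat) set" where
  "sites = {1..} \<times> {1..}"

text \<open>Only the variables indexed by \<^term>\<open>sites\<close> matter; the value \<^term>\<open>True\<close> plays the role of 1.\<close>

definition iid_bernoulli :: "'a measure \<Rightarrow> real \<Rightarrow> (nat \<times> nat \<Rightarrow> 'a \<Rightarrow> bool) \<Rightarrow> bool" where
  "iid_bernoulli M p X \<longleftrightarrow>
     prob_space M \<and>
     prob_space.indep_vars M (\<lambda>_. count_space UNIV) X sites \<and>
     (\<forall>s\<in>sites. distr M (count_space UNIV) (X s) = measure_pmf (bernoulli_pmf p))"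

definition iid_geometric :: "'a measure \<Rightarrow> real \<Rightarrow> (nat \<times> nat \<Rightarrow> 'a \<Rightarrow> nat) \<Rightarrow> bool" where
  "iid_geometric M p W \<longleftrightarrow>
     prob_space M \<and>
     prob_space.indep_vars M (\<lambda>_. count_space UNIV) W sites \<and>
     (\<forall>s\<in>sites. \<forall>k. \<P>(\<omega> in M. W s \<omega> = k) = p ^ k * (1 - p))"

definition random_set :: "(nat \<times> nat \<Rightarrow> 'a \<Rightarrow> bool) \<Rightarrow> 'a \<Rightarrow> (nat \<times> nat) set" where
  "random_set X \<omega> = {s \<in> sites. X s \<omega>}"

definition hprec :: "nat \<times> nat \<Rightarrow> nat \<times> nat \<Rightarrow> nat \<times> nat \<Rightarrow> bool" where
  "hprec h s t \<longleftrightarrow> fst s + fst h \<le> fst t \<and> snd s + snd h \<le> snd t"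

definition hchains :: "nat \<times> nat \<Rightarrow> (nat \<times> nat) set \<Rightarrow> nat \<Rightarrow> nat \<Rightarrow> (nat \<times> nat) list set" where
  "hchains h S m n =
     {ps. set ps \<subseteq> S \<inter> ({1..m} \<times> {1..n}) \<and>
          sorted (map fst ps) \<and> sorted (map snd ps) \<and> successively (hprec h) ps}"

text \<open>For \<^term>\<open>h \<noteq> (0, 0)\<close> the elements of a chain are pairwise distinct, so the maximum is over
  a finite set, which contains 0 because of the empty chain. For \<^term>\<open>h = (0, 0)\<close> the value is
  meaningless as soon as the box contains a point of \<^term>\<open>S\<close>.\<close>

definition longest_chain :: "nat \<times> nat \<Rightarrow> (nat \<times> nat) set \<Rightarrow> nat \<Rightarrow> nat \<Rightarrow> nat" where
  "longest_chain h S m n = Max {length ps |ps. ps \<in> hchains h S m n}"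

definition unit_step :: "nat \<times> nat \<Rightarrow> nat \<times> nat \<Rightarrow> bool" where
  "unit_step s t \<longleftrightarrow> t = (fst s + 1, snd s) \<or> t = (fst s, snd s + 1)"

definition lattice_paths :: "nat \<Rightarrow> nat \<Rightarrow> (nat \<times> nat) list set" where
  "lattice_paths m n =
     {P. P \<noteq> [] \<and> hd P = (1, 1) \<and> last P = (m, n) \<and> successively unit_step P}"

text \<open>The arguments are integers so that \<open>m - h\<^sub>1 k\<close> can be negative.\<close>

definition last_passage :: "(nat \<times> nat \<Rightarrow> nat) \<Rightarrow> int \<Rightarrow> int \<Rightarrow> nat" where
  "last_passage w m n =
     (if m \<le> 0 \<or> n \<le> 0 then 0
      else Max {(\<Sum>s\<in>set P. w s) |P. P \<in> lattice_paths (nat m) (nat n)})"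

end

theory Submission
  imports Defs
begin

text \<open>
  Truncated last passage times and suitably shifted chain lengths form random fields with the
  same law. Write \<open>L(i, j)\<close> for the length of a longest chain in \<open>{1..i} \<times> {1..j}\<close>, \<open>T(x)\<close> for the last passage time to \<open>x\<close>,
  and put \<open>a = m - h\<^sub>1 k\<close>, \<open>b = n - h\<^sub>2 k\<close>. If one of these is at most 0, both events are certain.
  Otherwise consider on \<open>{1..a} \<times> {1..b}\<close> two fields with values in \<open>{0..k + 1}\<close>. The passage
  profile is \<open>min (k + 1) T\<close>. The chain profile is the function \<open>\<lambda>\<close> such that, for \<open>t \<le> k\<close>,
  \<open>\<lambda>(x) > t\<close> holds exactly when \<open>L(x + t h) > t\<close>. Since \<open>(m, n) = (a, b) + k h\<close>, the two events
  of the theorem say that the respective profile is at most \<open>k\<close> at the corner \<open>(a, b)\<close>. It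
  therefore suffices that the two profiles have the same law.

  For a candidate profile \<open>\<tau>\<close> let \<open>s(x)\<close> be the larger of its values at the west and south
  neighbours of \<open>x\<close>. The passage profile equals \<open>\<tau>\<close> iff \<open>\<tau>(x) = min (k + 1) (s(x) + w(x))\<close> for
  all \<open>x\<close>. A geometric weight counts successes before the first failure in a sequence of coins;
  so this asks, at each \<open>x\<close>, that the coins at levels \<open>s(x), ..., \<tau>(x) - 1\<close> succeed and the one
  at level \<open>\<tau>(x)\<close>, if that level is at most \<open>k\<close>, fails.

  Looking at the last point of a chain gives, for the chain profile,
  \<open>\<lambda>(x) > t\<close> iff \<open>s(x) > t\<close>, or \<open>\<lambda>(x) \<ge> t\<close> and \<open>x + t h \<in> \<Xi>\<close>. Hence the chain profile equals
  \<open>\<tau>\<close> iff \<open>s \<le> \<tau>\<close> and the same coins come out in the same way, the coin of \<open>x\<close> at level \<open>t\<close> being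
  the Bernoulli variable at \<open>x + t h\<close>. These coins are independent because no site is used twice:
  if \<open>x + t h = x' + t' h\<close> with \<open>t < t'\<close>, then \<open>x'\<close> lies strictly south-west of \<open>x\<close> in the product
  order, so \<open>t' \<le> \<tau>(x') \<le> s(x) \<le> t\<close>, a contradiction
  (\<open>inj_on_shifted\<close>). Both laws are therefore the same product over the box
  (\<open>passage_profile_law\<close>, \<open>chain_profile_law\<close>).
\<close>

section \<open>Longest chains\<close>

lemma transp_hprec: "transp (hprec h)"
  by (auto simp: transp_def hprec_def)

lemma in_hchains_iff:
  "ps \<in> hchains h S m n \<longleftrightarrow> set ps \<subseteq> S \<inter> ({1..m} \<times> {1..n}) \<and> sorted_wrt (hprec h) ps"
proof -
  have "sorted (map fst ps) \<and> sorted (map snd ps)" if "sorted_wrt (hprec h) ps"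
    using that by (induction ps) (force simp: hprec_def)+
  then show ?thesis
    by (auto simp: hchains_def successively_conv_sorted_wrt[OF transp_hprec])
qed

text \<open>
  Since \<open>h \<noteq> (0, 0)\<close>, the sum of the coordinates grows strictly along a chain. This bounds the
  length of chains in a box, so that the maximum defining \<open>longest_chain\<close> is attained.
\<close>

lemma sorted_hprec_length_le:
  assumes "h \<noteq> (0, 0)" "sorted_wrt (hprec h) (ps @ [q])"
  shows "length ps \<le> fst q + snd q"
  using assms(2)
proof (induction ps arbitrary: q rule: rev_induct)
  case (snoc r ps)
  then have "length ps \<le> fst r + snd r" "hprec h r q"
    by (auto simp: sorted_wrt_append)
  then show ?case
    using assms(1) by (cases h) (auto simp: hprec_def)
qed simp

lemma hchain_length_le:
  assumes "h \<noteq> (0, 0)" "ps \<in> hchains h S m n"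
  shows "length ps \<le> Suc (m + n)"
proof (cases ps rule: rev_cases)
  case (snoc qs q)
  then have "length qs \<le> fst q + snd q" "fst q \<le> m" "snd q \<le> n"
    using assms sorted_hprec_length_le[of h qs q] by (auto simp: in_hchains_iff)
  then show ?thesis using snoc by simp
qed simp

text \<open>
  Prefixes of chains are chains, so a chain of every length up to the maximum exists.
\<close>

lemma le_longest_chain_iff:
  assumes "h \<noteq> (0, 0)"
  shows "l \<le> longest_chain h S m n \<longleftrightarrow> (\<exists>ps\<in>hchains h S m n. length ps = l)"
proof -
  let ?A = "{length ps |ps. ps \<in> hchains h S m n}"
  have "?A \<subseteq> {..Suc (m + n)}"
    using hchain_length_le[OF assms] by auto
  then have fin: "finite ?A" by (rule finite_subset) simp
  have "[] \<in> hchains h S m n" by (simp add: in_hchains_iff)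
  then have ne: "?A \<noteq> {}" by blast
  show ?thesis
  proof
    assume l: "l \<le> longest_chain h S m n"
    obtain ps where ps: "ps \<in> hchains h S m n" "length ps = longest_chain h S m n"
      using Max_in[OF fin ne] unfolding longest_chain_def by force
    have "take l ps \<in> hchains h S m n"
      using ps(1) set_take_subset[of l ps] by (auto simp: in_hchains_iff sorted_wrt_take)
    then show "\<exists>ps\<in>hchains h S m n. length ps = l"
      using ps(2) l by (intro bexI[of _ "take l ps"]) auto
  next
    assume "\<exists>ps\<in>hchains h S m n. length ps = l"
    then show "l \<le> longest_chain h S m n"
      unfolding longest_chain_def using fin by (intro Max_ge) auto
  qed
qed

lemma longest_chain_mono:
  assumes "h \<noteq> (0, 0)" "m \<le> m'" "n \<le> n'"
  shows "longest_chain h S m n \<le> longest_chain h S m' n'"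
proof -
  have "hchains h S m n \<subseteq> hchains h S m' n'"
    using assms by (force simp: in_hchains_iff)
  then show ?thesis
    using le_longest_chain_iff[OF assms(1)] by blast
qed

lemma longest_chain_drop_last:
  assumes "h \<noteq> (0, 0)" "Suc l \<le> longest_chain h S m n"
  shows "l \<le> longest_chain h S (m - fst h) (n - snd h)"
proof -
  obtain ps where ps: "ps \<in> hchains h S m n" "length ps = Suc l"
    using assms le_longest_chain_iff by blast
  then obtain qs q where "ps = qs @ [q]" by (cases ps rule: rev_cases) auto
  then have "qs \<in> hchains h S (m - fst h) (n - snd h)" "length qs = l"
    using ps by (fastforce simp: in_hchains_iff sorted_wrt_append hprec_def)+
  then show ?thesis using assms(1) le_longest_chain_iff by blast
qed

text \<open>
  A chain either avoids the last column, or avoids the last row, or ends in the corner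
  \<open>(m, n)\<close>; in the last case the other points lie in the box cut down by \<open>h\<close>. The truncated
  subtraction is harmless: a box with a side 0 carries only the empty chain, which may precede
  any point.
\<close>

lemma longest_chain_rec:
  assumes h: "h \<noteq> (0, 0)" and mn: "1 \<le> m" "1 \<le> n"
  shows "Suc t \<le> longest_chain h S m n \<longleftrightarrow>
    Suc t \<le> longest_chain h S (m - 1) n \<or> Suc t \<le> longest_chain h S m (n - 1) \<or>
    (m, n) \<in> S \<and> t \<le> longest_chain h S (m - fst h) (n - snd h)"
    (is "?L \<longleftrightarrow> ?W \<or> ?S \<or> ?P")
proof
  assume L: ?L
  then obtain ps where ps: "ps \<in> hchains h S m n" "length ps = Suc t"
    using le_longest_chain_iff[OF h] by blast
  then obtain qs i j where q: "ps = qs @ [(i, j)]"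
    by (cases ps rule: rev_cases) auto
  have "i \<le> m" "j \<le> n" "(i, j) \<in> S" using ps q by (auto simp: in_hchains_iff)
  moreover have "ps \<in> hchains h S i j"
    using ps q by (fastforce simp: in_hchains_iff sorted_wrt_append hprec_def)
  then have "Suc t \<le> longest_chain h S i j"
    using ps le_longest_chain_iff[OF h] by blast
  then have "Suc t \<le> longest_chain h S i' j'" if "i \<le> i'" "j \<le> j'" for i' j'
    using longest_chain_mono[OF h that] order_trans by blast
  ultimately show "?W \<or> ?S \<or> ?P"
    using longest_chain_drop_last[OF h L] by (cases "i = m"; cases "j = n") auto
next
  have "?L" if P: "?P"
  proof -
    obtain ps where ps: "ps \<in> hchains h S (m - fst h) (n - snd h)" "length ps = t"
      using P le_longest_chain_iff[OF h] by blast
    then have "ps @ [(m, n)] \<in> hchains h S m n"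
      using P mn by (fastforce simp: in_hchains_iff sorted_wrt_append hprec_def)
    then show ?L
      using ps(2) le_longest_chain_iff[OF h] by (metis length_append_singleton)
  qed
  moreover have "?L" if "?W \<or> ?S"
    using that longest_chain_mono[OF h, of "m - 1" m n n] longest_chain_mono[OF h, of m m "n - 1" n]
    by (auto intro: order_trans)
  ultimately show "?W \<or> ?S \<or> ?P \<Longrightarrow> ?L" by blast
qed

text \<open>
  The point number \<open>k + 1\<close> of a chain has coordinates larger than \<open>k h\<close>.
\<close>

lemma longest_chain_le_of_thin_box:
  assumes h: "h \<noteq> (0, 0)" and "m \<le> fst h * k \<or> n \<le> snd h * k"
  shows "longest_chain h S m n \<le> k"
  using assms(2)
proof (induction k arbitrary: m n)
  case 0
  then have "hchains h S m n \<subseteq> {[]}" by (auto simp: in_hchains_iff)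
  then show ?case 
    using le_longest_chain_iff[OF h, of "Suc 0" S m n]
    by (metis (no_types, opaque_lifting) One_nat_def length_greater_0_conv not_less_eq_eq singletonD subsetD zero_less_one)
next
  case (Suc k)
  then have "longest_chain h S (m - fst h) (n - snd h) \<le> k"
    by (intro Suc.IH) auto
  then show ?case using longest_chain_drop_last[OF h, of "Suc k" S m n] by linarith
qed

section \<open>Last passage times\<close>

lemma lattice_pathD:
  assumes "successively unit_step P" "P \<noteq> []" "hd P = (1, 1)"
  shows "set P \<subseteq> {1..fst (last P)} \<times> {1..snd (last P)} \<and> distinct P"
  using assms
proof (induction P rule: rev_induct)
  case (snoc x P)
  show ?case
  proof (cases "P = []")
    case False
    with snoc have *: "set P \<subseteq> {1..fst (last P)} \<times> {1..snd (last P)}" "distinct P" "unit_step (last P) x"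
      by (auto simp: successively_append_iff)
    have "last P \<in> {1..fst (last P)} \<times> {1..snd (last P)}"
      using False * last_in_set by blast
    then have "1 \<le> fst (last P)" "1 \<le> snd (last P)"
      by (auto simp: mem_Times_iff)
    moreover have "x \<notin> set P" using * by (auto simp: unit_step_def)
    ultimately show ?thesis using * by (fastforce simp: unit_step_def)
  qed (use snoc in auto)
qed simp

lemma finite_lattice_paths: "finite (lattice_paths m n)"
proof (rule finite_subset)
  show "lattice_paths m n \<subseteq> {P. set P \<subseteq> {1..m} \<times> {1..n} \<and> distinct P}"
    using lattice_pathD by (fastforce simp: lattice_paths_def)
  show "finite {P. set P \<subseteq> {1..m} \<times> {1..n} \<and> distinct P}"
    by (rule finite_subset_distinct) simp
qed

lemma lattice_paths_0: "m = 0 \<or> n = 0 \<Longrightarrow> lattice_paths m n = {}"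
  using lattice_pathD last_in_set by (fastforce simp: lattice_paths_def)


lemma lattice_paths_1_1: "lattice_paths 1 1 = {[(1, 1)]}"
proof
  show "lattice_paths 1 1 \<subseteq> {[(1, 1)]}"
  proof
    fix P assume "P \<in> lattice_paths 1 1"
    then have "P \<noteq> []" "set P \<subseteq> {(1, 1)}" "distinct P"
      using lattice_pathD[of P] by (auto simp: lattice_paths_def)
    then show "P \<in> {[(1, 1)]}"
      by (cases P; cases "tl P") auto
  qed
qed (simp add: lattice_paths_def)

lemma lattice_paths_rec:
  assumes "1 \<le> m" "1 \<le> n" "(m, n) \<noteq> (1, 1)"
  shows "lattice_paths m n =
    (\<lambda>P. P @ [(m, n)]) ` (lattice_paths (m - 1) n \<union> lattice_paths m (n - 1))"
proof (intro equalityI subsetI)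
  fix P assume "P \<in> lattice_paths m n"
  then have P: "P \<noteq> []" "hd P = (1, 1)" "last P = (m, n)" "successively unit_step P"
    by (auto simp: lattice_paths_def)
  define Q where "Q = butlast P"
  have PQ: "P = Q @ [(m, n)]" using P by (metis Q_def append_butlast_last_id)
  with P assms have "Q \<noteq> []" by auto
  then have Q: "Q \<noteq> []" "hd Q = (1, 1)" "successively unit_step Q" "unit_step (last Q) (m, n)"
    using P PQ by (auto simp: successively_append_iff)
  then have "last Q = (m - 1, n) \<or> last Q = (m, n - 1)"
    by (cases "last Q") (auto simp: unit_step_def)
  then have "Q \<in> lattice_paths (m - 1) n \<union> lattice_paths m (n - 1)"
    using Q by (auto simp: lattice_paths_def)
  then show "P \<in> (\<lambda>P. P @ [(m, n)]) ` (lattice_paths (m - 1) n \<union> lattice_paths m (n - 1))"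
    using PQ by blast
next
  fix P assume "P \<in> (\<lambda>P. P @ [(m, n)]) ` (lattice_paths (m - 1) n \<union> lattice_paths m (n - 1))"
  then show "P \<in> lattice_paths m n"
    using assms by (auto simp: lattice_paths_def successively_append_iff unit_step_def)
qed

lemma lattice_paths_nonempty: "1 \<le> m \<Longrightarrow> 1 \<le> n \<Longrightarrow> lattice_paths m n \<noteq> {}"
proof (induction "m + n" arbitrary: m n rule: less_induct)
  case less
  show ?case
  proof (cases "(m, n) = (1, 1)")
    case False
    then have "lattice_paths (m - 1) n \<noteq> {} \<or> lattice_paths m (n - 1) \<noteq> {}"
      using less.hyps[of "m - 1" n] less.hyps[of m "n - 1"] less.prems
      by (cases "m = 1"; cases "n = 1") auto
    then show ?thesis using lattice_paths_rec[OF less.prems False] by blast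
  qed (simp add: lattice_paths_1_1[simplified])
qed

definition path_weights :: "(nat \<times> nat \<Rightarrow> nat) \<Rightarrow> nat \<Rightarrow> nat \<Rightarrow> nat set" where
  "path_weights w m n = (\<lambda>P. \<Sum>s\<in>set P. w s) ` lattice_paths m n"

lemma finite_path_weights: "finite (path_weights w m n)"
  by (simp add: path_weights_def finite_lattice_paths)

text \<open>
  Inserting 0 covers the boundary convention as well, because no path from \<open>(1, 1)\<close> reaches a site
  with a coordinate 0.
\<close>

lemma last_passage_eq_Max:
  "last_passage w (int m) (int n) = Max (insert 0 (path_weights w m n))"
proof (cases "m = 0 \<or> n = 0")
  case True
  then show ?thesis by (auto simp: last_passage_def path_weights_def lattice_paths_0)
next
  case False
  then have "path_weights w m n \<noteq> {}"
    using lattice_paths_nonempty[of m n] by (simp add: path_weights_def)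
  then have "Max (insert 0 (path_weights w m n)) = Max (path_weights w m n)"
    by (simp add: finite_path_weights)
  then show ?thesis
    using False by (simp add: last_passage_def path_weights_def Setcompr_eq_image)
qed

lemma last_passage_rec:
  assumes "1 \<le> m" "1 \<le> n"
  shows "last_passage w (int m) (int n) =
    max (last_passage w (int (m - 1)) (int n)) (last_passage w (int m) (int (n - 1))) + w (m, n)"
proof (cases "(m, n) = (1, 1)")
  case True
  then have "path_weights w m n = {w (m, n)}"
    using lattice_paths_1_1 by (simp add: path_weights_def)
  moreover have "path_weights w (m - 1) n = {}" "path_weights w m (n - 1) = {}"
    using True by (simp_all add: path_weights_def lattice_paths_0)
  ultimately show ?thesis by (simp add: last_passage_eq_Max)
next
  case False
  let ?U = "path_weights w (m - 1) n \<union> path_weights w m (n - 1)"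
  have avoid: "(m, n) \<notin> set P" if "P \<in> lattice_paths (m - 1) n \<union> lattice_paths m (n - 1)" for P
  proof -
    have "set P \<subseteq> {1..fst (last P)} \<times> {1..snd (last P)}"
      using that lattice_pathD[of P] by (simp add: lattice_paths_def) blast
    moreover have "last P = (m - 1, n) \<or> last P = (m, n - 1)"
      using that by (simp add: lattice_paths_def) blast
    ultimately show ?thesis using assms by force
  qed
  have "path_weights w m n = (\<lambda>P. (\<Sum>s\<in>set P. w s) + w (m, n)) `
      (lattice_paths (m - 1) n \<union> lattice_paths m (n - 1))"
    unfolding path_weights_def lattice_paths_rec[OF assms False] image_image
    using avoid by (intro image_cong) auto
  then have eq: "path_weights w m n = (\<lambda>v. v + w (m, n)) ` ?U"
    by (auto simp: path_weights_def image_image image_Un)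
  have fin: "finite ?U" by (simp add: finite_path_weights)
  have ne: "?U \<noteq> {}"
    using eq lattice_paths_nonempty[OF assms] by (auto simp: path_weights_def)
  have "Max (insert 0 (path_weights w m n)) = Max (path_weights w m n)"
    using eq ne by (simp add: finite_path_weights)
  also have "\<dots> = Max ?U + w (m, n)"
    using Max_add_commute[OF fin ne, of "\<lambda>v. v" "w (m, n)"] eq by simp
  also have "Max ?U = Max (insert 0 ?U)"
    using fin ne by simp
  also have "insert 0 ?U = insert 0 (path_weights w (m - 1) n) \<union> insert 0 (path_weights w m (n - 1))"
    by blast
  also have "Max \<dots> = max (Max (insert 0 (path_weights w (m - 1) n)))
      (Max (insert 0 (path_weights w m (n - 1))))"
    by (intro Max_Un) (simp_all add: finite_path_weights)
  finally show ?thesis by (simp add: last_passage_eq_Max)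
qed

section \<open>Profiles\<close>

text \<open>
  The value 0 outside the box supplies the boundary condition of the recursions and makes the
  set of profiles finite.
\<close>

definition profiles :: "nat \<Rightarrow> nat \<Rightarrow> nat \<Rightarrow> (nat \<times> nat \<Rightarrow> nat) set" where
  "profiles k a b =
     {\<tau>. (\<forall>x\<in>{1..a} \<times> {1..b}. \<tau> x \<le> Suc k) \<and> (\<forall>x. x \<notin> {1..a} \<times> {1..b} \<longrightarrow> \<tau> x = 0)}"

text \<open>The value that \<open>\<tau>\<close> inherits at \<open>x\<close> from its west and south neighbours.\<close>

definition base_level :: "(nat \<times> nat \<Rightarrow> nat) \<Rightarrow> nat \<times> nat \<Rightarrow> nat" where
  "base_level \<tau> x = max (\<tau> (fst x - 1, snd x)) (\<tau> (fst x, snd x - 1))"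

lemma finite_profiles: "finite (profiles k a b)"
proof -
  have "profiles k a b = {\<tau>. \<forall>x. (x \<in> {1..a} \<times> {1..b} \<longrightarrow> \<tau> x \<in> {..Suc k}) \<and>
      (x \<notin> {1..a} \<times> {1..b} \<longrightarrow> \<tau> x = 0)}"
    unfolding profiles_def by (intro Collect_cong) blast
  also have "finite \<dots>" by (intro finite_set_of_finite_funs) auto
  finally show ?thesis .
qed

lemma profile_outside: "\<tau> \<in> profiles k a b \<Longrightarrow> x \<notin> {1..a} \<times> {1..b} \<Longrightarrow> \<tau> x = 0"
  unfolding profiles_def by blast

lemma profile_le:
  assumes "\<tau> \<in> profiles k a b"
  shows "\<tau> x \<le> Suc k"
proof (cases "x \<in> {1..a} \<times> {1..b}")
  case True
  then show ?thesis using assms unfolding profiles_def by blast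
next
  case False
  then show ?thesis using profile_outside[OF assms] by simp
qed

lemma base_level_le: "\<tau> \<in> profiles k a b \<Longrightarrow> base_level \<tau> x \<le> Suc k"
  by (simp add: base_level_def profile_le)

lemma box_induct [consumes 1, case_names step]:
  assumes "x \<in> {1..a} \<times> {1..b}"
    and "\<And>x. x \<in> {1..a} \<times> {1..b} \<Longrightarrow>
      (\<And>y. y \<in> {(fst x - 1, snd x), (fst x, snd x - 1)} \<Longrightarrow> y \<in> {1..a} \<times> {1..b} \<Longrightarrow> P y) \<Longrightarrow> P x"
  shows "P (x :: nat \<times> nat)"
  using assms(1)
proof (induction "fst x + snd x" arbitrary: x rule: less_induct)
  case less
  show ?case
  proof (rule assms(2)[OF less.prems])
    fix y assume "y \<in> {(fst x - 1, snd x), (fst x, snd x - 1)}" "y \<in> {1..a} \<times> {1..b}"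
    then show "P y" using less.prems by (intro less.hyps) auto
  qed
qed

text \<open>
  A profile is determined by any rule that computes its value at each \<open>x\<close> from the inherited one;
  the boundary values are 0.
\<close>

lemma profiles_eqI:
  assumes \<sigma>: "\<sigma> \<in> profiles k a b" and \<tau>: "\<tau> \<in> profiles k a b"
    and step: "\<And>x. x \<in> {1..a} \<times> {1..b} \<Longrightarrow> base_level \<sigma> x = base_level \<tau> x \<Longrightarrow> \<sigma> x = \<tau> x"
  shows "\<sigma> = \<tau>"
proof
  fix x
  have "\<sigma> x = \<tau> x" if "x \<in> {1..a} \<times> {1..b}"
    using that
  proof (induction x rule: box_induct)
    case (step x)
    then have "\<sigma> y = \<tau> y" if "y \<in> {(fst x - 1, snd x), (fst x, snd x - 1)}" for y
      using that profile_outside[OF \<sigma>, of y] profile_outside[OF \<tau>, of y] by metis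
    then have "base_level \<sigma> x = base_level \<tau> x" by (simp add: base_level_def)
    with step.hyps show ?case by (rule assms(3))
  qed
  then show "\<sigma> x = \<tau> x" using \<sigma> \<tau> profile_outside by metis
qed

text \<open>
  A profile that never falls below its inherited value is monotone in the product order. For
  \<open>x \<noteq> y\<close>, a monotone walk from \<open>x\<close> to \<open>y\<close> enters \<open>y\<close> from the west or the south, so \<open>\<tau> x\<close> is
  bounded even by the value inherited at \<open>y\<close>.
\<close>

lemma profile_strict_le_base:
  assumes \<tau>: "\<And>x. x \<in> {1..a} \<times> {1..b} \<Longrightarrow> base_level \<tau> x \<le> \<tau> x"
    and "y \<in> {1..a} \<times> {1..b}" "x \<in> {1..a} \<times> {1..b}"
    and "fst x \<le> fst y" "snd x \<le> snd y" "x \<noteq> y"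
  shows "\<tau> x \<le> base_level \<tau> y"
  using assms(2-)
proof (induction y rule: box_induct)
  case (step y)
  have IH: "\<tau> x \<le> \<tau> z" if "z \<in> {(fst y - 1, snd y), (fst y, snd y - 1)}" "z \<in> {1..a} \<times> {1..b}"
    "fst x \<le> fst z" "snd x \<le> snd z" for z
    using step.IH[OF that(1,2)] \<tau>[OF that(2)] step.prems(1) that(3,4) by (cases "x = z") auto
  consider "fst x < fst y" | "snd x < snd y"
    using step.prems by (metis le_neq_implies_less prod_eqI)
  then show ?case
  proof cases
    case 1
    then have "\<tau> x \<le> \<tau> (fst y - 1, snd y)"
      using step.prems step.hyps by (intro IH) (auto simp: mem_Times_iff)
    then show ?thesis by (simp add: base_level_def)
  next
    case 2
    then have "\<tau> x \<le> \<tau> (fst y, snd y - 1)"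
      using step.prems step.hyps by (intro IH) (auto simp: mem_Times_iff)
    then show ?thesis by (simp add: base_level_def)
  qed
qed

section \<open>The passage profile\<close>

definition passage_profile :: "(nat \<times> nat \<Rightarrow> nat) \<Rightarrow> nat \<Rightarrow> nat \<Rightarrow> nat \<Rightarrow> nat \<times> nat \<Rightarrow> nat" where
  "passage_profile w k a b x =
     (if x \<in> {1..a} \<times> {1..b} then min (Suc k) (last_passage w (int (fst x)) (int (snd x))) else 0)"

lemma passage_profile_in_profiles: "passage_profile w k a b \<in> profiles k a b"
  by (auto simp: passage_profile_def profiles_def)

text \<open>Truncation at \<open>k + 1\<close> commutes with the recursion of last passage times.\<close>

lemma passage_profile_rec:
  assumes "x \<in> {1..a} \<times> {1..b}"
  shows "passage_profile w k a b x = min (Suc k) (base_level (passage_profile w k a b) x + w x)"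
proof -
  obtain i j where x: "x = (i, j)" by (cases x)
  have eq: "passage_profile w k a b (i', j') = min (Suc k) (last_passage w (int i') (int j'))"
    if "i' \<le> i" "j' \<le> j" for i' j'
    using that assms x by (auto simp: passage_profile_def last_passage_def)
  have "last_passage w (int i) (int j) =
    max (last_passage w (int (i - 1)) (int j)) (last_passage w (int i) (int (j - 1))) + w (i, j)"
    using assms x by (intro last_passage_rec) auto
  then show ?thesis by (simp add: x base_level_def eq min_def max_def)
qed

lemma passage_profile_eq_iff:
  assumes "\<tau> \<in> profiles k a b"
  shows "passage_profile w k a b = \<tau> \<longleftrightarrow>
    (\<forall>x\<in>{1..a} \<times> {1..b}. \<tau> x = min (Suc k) (base_level \<tau> x + w x))" (is "?L \<longleftrightarrow> ?R")
proof
  show "?L \<Longrightarrow> ?R" using passage_profile_rec by blast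
next
  assume R: ?R
  show ?L
  proof (rule profiles_eqI[OF passage_profile_in_profiles assms])
    fix x assume x: "x \<in> {1..a} \<times> {1..b}"
      and "base_level (passage_profile w k a b) x = base_level \<tau> x"
    then show "passage_profile w k a b x = \<tau> x"
      using R passage_profile_rec[OF x] by metis
  qed
qed

section \<open>The chain profile\<close>

text \<open>The site \<open>x + t h\<close>, for a pair \<open>(x, t)\<close> of a box site and a level.\<close>

definition shifted :: "nat \<times> nat \<Rightarrow> (nat \<times> nat) \<times> nat \<Rightarrow> nat \<times> nat" where
  "shifted h z = (fst (fst z) + fst h * snd z, snd (fst z) + snd h * snd z)"

text \<open>
  The number of levels \<open>t \<le> k\<close> at which the chain length up to \<open>x + t h\<close> exceeds \<open>t\<close>; such levels
  form an initial segment, so their number is the first level that fails.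
\<close>

definition chain_profile ::
  "nat \<times> nat \<Rightarrow> (nat \<times> nat) set \<Rightarrow> nat \<Rightarrow> nat \<Rightarrow> nat \<Rightarrow> nat \<times> nat \<Rightarrow> nat" where
  "chain_profile h S k a b x =
     (if x \<in> {1..a} \<times> {1..b}
      then LEAST t. t = Suc k \<or> longest_chain h S (fst (shifted h (x, t))) (snd (shifted h (x, t))) \<le> t
      else 0)"

lemma chain_profile_in_profiles: "chain_profile h S k a b \<in> profiles k a b"
  by (auto simp: chain_profile_def profiles_def intro: Least_le)

text \<open>
  Dropping the last point of a chain lowers both the length and the level by one, so the levels
  that qualify are closed downwards. On the boundary, where the profile is 0 by definition,
  the chain lengths are too small to qualify.
\<close>

lemma less_chain_profile_iff:
  assumes h: "h \<noteq> (0, 0)" and "i \<le> a" "j \<le> b"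
  shows "t < chain_profile h S k a b (i, j) \<longleftrightarrow>
    t \<le> k \<and> t < longest_chain h S (i + fst h * t) (j + snd h * t)"
proof (cases "i = 0 \<or> j = 0")
  case True
  then have "longest_chain h S (i + fst h * t) (j + snd h * t) \<le> t"
    by (intro longest_chain_le_of_thin_box[OF h]) auto
  then show ?thesis using True by (auto simp: chain_profile_def)
next
  case False
  let ?L = "\<lambda>t. longest_chain h S (i + fst h * t) (j + snd h * t)"
  let ?Q = "\<lambda>t. t = Suc k \<or> ?L t \<le> t"
  have eq: "chain_profile h S k a b (i, j) = (LEAST t. ?Q t)"
    using False assms by (simp add: chain_profile_def shifted_def)
  have down: "t < ?L t" if "Suc t < ?L (Suc t)" for t
    using longest_chain_drop_last[OF h, of "Suc t" S "i + fst h * Suc t" "j + snd h * Suc t"] that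
    by (simp add: algebra_simps)
  \<comment> \<open>the qualifying levels form an initial segment\<close>
  have low: "t < ?L t" if "s < ?L s" "t \<le> s" for s t
    using that(2,1) by (induction rule: inc_induct) (auto intro: down)
  have Q: "?Q (LEAST t. ?Q t)" by (rule LeastI[of ?Q "Suc k"]) simp
  have le: "(LEAST t. ?Q t) \<le> Suc k" by (rule Least_le) simp
  show ?thesis
    unfolding eq
  proof
    assume t: "t < (LEAST t. ?Q t)"
    then show "t \<le> k \<and> t < ?L t" using not_less_Least[OF t] le by auto
  next
    assume t: "t \<le> k \<and> t < ?L t"
    show "t < (LEAST t. ?Q t)"
    proof (rule ccontr)
      assume "\<not> t < (LEAST t. ?Q t)"
      then have "(LEAST t. ?Q t) \<le> t" by simp
      moreover from this have "(LEAST t. ?Q t) < ?L (LEAST t. ?Q t)"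
        using low[of t "LEAST t. ?Q t"] t by blast
      ultimately show False using Q t by linarith
    qed
  qed
qed

text \<open>
  The recursion for longest chains at the corner \<open>x + t h\<close>: subtracting \<open>h\<close> from it gives the
  corner of the same \<open>x\<close> at level \<open>t - 1\<close>, so the chains that end in the corner are governed by
  the profile at \<open>x\<close> itself.
\<close>

lemma chain_profile_rec:
  fixes S :: "(nat \<times> nat) set"
  assumes h: "h \<noteq> (0, 0)" and x: "x \<in> {1..a} \<times> {1..b}" and t: "t \<le> k"
  defines "\<tau> \<equiv> chain_profile h S k a b"
  shows "t < \<tau> x \<longleftrightarrow> t < base_level \<tau> x \<or> t \<le> \<tau> x \<and> shifted h (x, t) \<in> S"
proof -
  obtain i j where ij: "x = (i, j)" "1 \<le> i" "i \<le> a" "1 \<le> j" "j \<le> b"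
    using x by (cases x) auto
  let ?m = "i + fst h * t" and ?n = "j + snd h * t"
  have "t \<le> \<tau> x \<longleftrightarrow> t \<le> longest_chain h S (?m - fst h) (?n - snd h)"
  proof (cases t)
    case (Suc u)
    then show ?thesis
      using less_chain_profile_iff[OF h ij(3,5), of u S k] t ij(1)
      by (auto simp: \<tau>_def Suc_le_eq algebra_simps)
  qed simp
  moreover have "t < base_level \<tau> x \<longleftrightarrow>
      t < longest_chain h S (?m - 1) ?n \<or> t < longest_chain h S ?m (?n - 1)"
    using less_chain_profile_iff[OF h, of "i - 1" a j b t S k]
      less_chain_profile_iff[OF h, of i a "j - 1" b t S k] ij t
    by (auto simp: \<tau>_def base_level_def less_max_iff_disj)
  moreover have "t < \<tau> x \<longleftrightarrow> t < longest_chain h S ?m ?n"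
    using less_chain_profile_iff[OF h ij(3,5), of t S k] t ij(1) by (simp add: \<tau>_def)
  ultimately show ?thesis
    using longest_chain_rec[OF h, of ?m ?n t S] ij by (auto simp: shifted_def Suc_le_eq)
qed

text \<open>
  Below the inherited value and above \<open>\<tau> x\<close> the recursion decides \<open>t < \<tau> x\<close> without consulting \<open>S\<close>;
  only the levels in between are read off from \<open>S\<close>.
\<close>

lemma chain_profile_eq_iff:
  assumes h: "h \<noteq> (0, 0)" and \<tau>: "\<tau> \<in> profiles k a b"
  shows "chain_profile h S k a b = \<tau> \<longleftrightarrow>
    (\<forall>x\<in>{1..a} \<times> {1..b}. base_level \<tau> x \<le> \<tau> x \<and>
      (\<forall>t\<in>{base_level \<tau> x..min k (\<tau> x)}. shifted h (x, t) \<in> S \<longleftrightarrow> t < \<tau> x))" (is "?L \<longleftrightarrow> ?R")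
proof
  assume L: ?L
  show ?R
  proof
    fix x assume x: "x \<in> {1..a} \<times> {1..b}"
    have rec: "t < \<tau> x \<longleftrightarrow> t < base_level \<tau> x \<or> t \<le> \<tau> x \<and> shifted h (x, t) \<in> S" if "t \<le> k" for t
      using chain_profile_rec[OF h x that, of S] L by simp
    have "base_level \<tau> x \<le> \<tau> x"
      using rec[of "\<tau> x"] base_level_le[OF \<tau>, of x] by (cases "\<tau> x \<le> k") auto
    then show "base_level \<tau> x \<le> \<tau> x \<and>
      (\<forall>t\<in>{base_level \<tau> x..min k (\<tau> x)}. shifted h (x, t) \<in> S \<longleftrightarrow> t < \<tau> x)"
      using rec by auto
  qed
next
  assume R: ?R
  show ?L
  proof (rule profiles_eqI[OF chain_profile_in_profiles \<tau>])
    let ?\<sigma> = "chain_profile h S k a b"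
    fix x assume x: "x \<in> {1..a} \<times> {1..b}" and base: "base_level ?\<sigma> x = base_level \<tau> x"
    have rec: "t < \<tau> x \<longleftrightarrow> t < base_level \<tau> x \<or> t \<le> \<tau> x \<and> shifted h (x, t) \<in> S" if "t \<le> k" for t
      using bspec[OF R x] that by (cases "t < base_level \<tau> x"; cases "t \<le> \<tau> x") auto
    have same: "t < ?\<sigma> x \<longleftrightarrow> t < \<tau> x" if "t \<le> k" for t
      using that
    proof (induction t)
      case 0
      then show ?case using rec[of 0] chain_profile_rec[OF h x, of 0 k S] base by simp
    next
      case (Suc t)
      then show ?case
        using rec[of "Suc t"] chain_profile_rec[OF h x, of "Suc t" k S] base by (simp add: Suc_le_eq)
    qed
    have "?\<sigma> x \<le> Suc k" "\<tau> x \<le> Suc k"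
      using profile_le[OF chain_profile_in_profiles] profile_le[OF \<tau>] by auto
    then show "?\<sigma> x = \<tau> x"
      using same[of "?\<sigma> x"] same[of "\<tau> x"] by (cases "?\<sigma> x" "\<tau> x" rule: linorder_cases) auto
  qed
qed

text \<open>
  No site is consulted twice. If two pairs give the same site, the pair with the higher level
  \<open>t'\<close> belongs to an \<open>x'\<close> preceding \<open>x\<close>; monotonicity then makes the value inherited at \<open>x\<close> at least
  \<open>\<tau> x' \<ge> t'\<close>, which rules out the lower level \<open>t\<close> at \<open>x\<close>.
\<close>

lemma inj_on_shifted:
  assumes h: "h \<noteq> (0, 0)" 
    and \<tau>: "\<And>x. x \<in> {1..a} \<times> {1..b} \<Longrightarrow> base_level \<tau> x \<le> \<tau> x"
  shows "inj_on (shifted h) (SIGMA x:{1..a} \<times> {1..b}. {base_level \<tau> x..min k (\<tau> x)})"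
    (is "inj_on _ ?A")
proof -
  have level_le: "t' \<le> t"
    if A: "(x, t) \<in> ?A" "(x', t') \<in> ?A" and eq: "shifted h (x, t) = shifted h (x', t')" for x t x' t'
  proof (rule ccontr)
    assume "\<not> t' \<le> t"
    then have "t < t'" by simp
    then obtain d where t': "t' = t + d" "0 < d" using less_imp_add_positive by blast
    have coord: "fst x = fst x' + fst h * d" "snd x = snd x' + snd h * d"
      using eq by (simp_all add: shifted_def t' algebra_simps)
    have "x' \<noteq> x"
      using coord h t'(2) by (cases h) auto
    then have "\<tau> x' \<le> base_level \<tau> x"
      using A coord by (intro profile_strict_le_base[OF \<tau>]) auto
    then show False using A \<open>t < t'\<close> by auto
  qed
  show ?thesis
  proof (rule inj_onI)
    fix y z assume A: "y \<in> ?A" "z \<in> ?A" and eq: "shifted h y = shifted h z"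
    have "snd y = snd z"
      using level_le[of "fst y" "snd y" "fst z" "snd z"] level_le[of "fst z" "snd z" "fst y" "snd y"] A eq
      by (metis le_antisym prod.collapse)
    then show "y = z" using eq by (simp add: shifted_def prod_eq_iff)
  qed
qed

section \<open>The common law of the two profiles\<close>

text \<open>
  The probability that a run of independent coins with success probability \<open>p\<close>, started at level
  \<open>s\<close> and stopped at the first failure or on reaching \<open>k + 1\<close>, ends at level \<open>t\<close>. A run
  that reaches \<open>k + 1\<close> ends without a failure, hence the case distinction in the last factor.
\<close>

definition step_weight :: "real \<Rightarrow> nat \<Rightarrow> nat \<Rightarrow> nat \<Rightarrow> real" where
  "step_weight p k s t = (if t < s then 0 else p ^ (t - s) * (if t \<le> k then 1 - p else 1))"

lemma prod_coins_eq_step_weight: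
  assumes "s \<le> t" "t \<le> Suc k"
  shows "(\<Prod>u\<in>{s..min k t}. if u < t then p else 1 - p) = step_weight p k s t"
proof (cases "t \<le> k")
  case True
  then have "{s..min k t} = insert t {s..<t}" using assms by auto
  then show ?thesis using True assms by (simp add: step_weight_def)
next
  case False
  then have "{s..min k t} = {s..<t}" using assms by auto
  then show ?thesis using False assms by (simp add: step_weight_def)
qed

lemma (in prob_space) prob_clipped_geometric:
  assumes W: "random_variable (count_space UNIV) W"
    and geo: "\<And>i. prob {\<omega> \<in> space M. W \<omega> = i} = p ^ i * (1 - p)"
    and "s \<le> Suc k" "t \<le> Suc k"
  shows "prob {\<omega> \<in> space M. t = min (Suc k) (s + W \<omega>)} = step_weight p k s t"
proof -
  have meas [measurable]: "{\<omega> \<in> space M. W \<omega> = i} \<in> events" for i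
    using W by measurable
  have tail: "prob {\<omega> \<in> space M. r \<le> W \<omega>} = p ^ r" for r
  proof (induction r)
    case 0
    then show ?case by (simp add: prob_space)
  next
    case (Suc r)
    have ev: "{\<omega> \<in> space M. Suc r \<le> W \<omega>} \<in> events" using W by measurable
    have "{\<omega> \<in> space M. r \<le> W \<omega>} = {\<omega> \<in> space M. W \<omega> = r} \<union> {\<omega> \<in> space M. Suc r \<le> W \<omega>}"
      by auto
    also have "prob \<dots> = prob {\<omega> \<in> space M. W \<omega> = r} + prob {\<omega> \<in> space M. Suc r \<le> W \<omega>}"
      using ev by (intro finite_measure_Union meas) auto
    finally show ?case using Suc by (simp add: geo algebra_simps)
  qed
  consider "t < s" | "s \<le> t" "t \<le> k" | "s \<le> t" "t = Suc k" using assms by linarith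
  then show ?thesis
  proof cases
    case 1
    then have "{\<omega> \<in> space M. t = min (Suc k) (s + W \<omega>)} = {}" using assms by auto
    then show ?thesis using 1 by (simp only: step_weight_def measure_empty if_True)
  next
    case 2
    then have "{\<omega> \<in> space M. t = min (Suc k) (s + W \<omega>)} = {\<omega> \<in> space M. W \<omega> = t - s}" by auto
    then show ?thesis using 2 geo by (simp add: step_weight_def)
  next
    case 3
    then have "{\<omega> \<in> space M. t = min (Suc k) (s + W \<omega>)} = {\<omega> \<in> space M. t - s \<le> W \<omega>}" by auto
    then show ?thesis using 3 tail by (simp add: step_weight_def)
  qed
qed

text \<open>
  Independence read along an injective list of sites. The reindexing by \<open>f\<close> lets the coins of
  the chain profile be indexed by pairs of a box site and a level.
\<close>

lemma (in prob_space) indep_vars_prob_all: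
  assumes X: "indep_vars (\<lambda>_. count_space UNIV) X I"
    and J: "finite J" "inj_on f J" "f ` J \<subseteq> I"
  shows "{\<omega> \<in> space M. \<forall>j\<in>J. X (f j) \<omega> \<in> V j} \<in> events"
    and "prob {\<omega> \<in> space M. \<forall>j\<in>J. X (f j) \<omega> \<in> V j} =
      (\<Prod>j\<in>J. prob {\<omega> \<in> space M. X (f j) \<omega> \<in> V j})"
proof -
  have rv: "random_variable (count_space UNIV) (X (f j))" if "j \<in> J" for j
    using X J that by (auto simp: indep_vars_def)
  have "{\<omega> \<in> space M. X (f j) \<omega> \<in> V j} \<in> events" if "j \<in> J" for j
    using measurable_sets[OF rv[OF that], of "V j"] by (simp add: vimage_def Int_def conj_commute)
  then show "{\<omega> \<in> space M. \<forall>j\<in>J. X (f j) \<omega> \<in> V j} \<in> events"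
    using J(1) by (rule sets.sets_Collect_finite_All)
  show "prob {\<omega> \<in> space M. \<forall>j\<in>J. X (f j) \<omega> \<in> V j} =
      (\<Prod>j\<in>J. prob {\<omega> \<in> space M. X (f j) \<omega> \<in> V j})"
  proof (cases "J = {}")
    case False
    define U where "U i = V (the_inv_into J f i)" for i
    have U: "U (f j) = V j" if "j \<in> J" for j
      using that J by (simp add: U_def the_inv_into_f_f)
    have "prob (\<Inter>i\<in>f ` J. X i -` U i \<inter> space M) = (\<Prod>i\<in>f ` J. prob (X i -` U i \<inter> space M))"
      using False J by (intro indep_varsD[OF X]) auto
    also have "\<dots> = (\<Prod>j\<in>J. prob (X (f j) -` V j \<inter> space M))"
      using J U by (simp add: prod.reindex)
    also have "(\<Inter>i\<in>f ` J. X i -` U i \<inter> space M) = {\<omega> \<in> space M. \<forall>j\<in>J. X (f j) \<omega> \<in> V j}"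
      using False U by auto
    also have "(\<lambda>j. X (f j) -` V j \<inter> space M) = (\<lambda>j. {\<omega> \<in> space M. X (f j) \<omega> \<in> V j})"
      by auto
    finally show ?thesis .
  qed (simp add: prob_space)
qed

definition profile_weight :: "real \<Rightarrow> nat \<Rightarrow> nat \<Rightarrow> nat \<Rightarrow> (nat \<times> nat \<Rightarrow> nat) \<Rightarrow> real" where
  "profile_weight p k a b \<tau> = (\<Prod>x\<in>{1..a} \<times> {1..b}. step_weight p k (base_level \<tau> x) (\<tau> x))"

lemma (in prob_space) prob_profile_le:
  assumes F: "\<And>\<omega>. F \<omega> \<in> profiles k a b"
    and law: "\<And>\<tau>. \<tau> \<in> profiles k a b \<Longrightarrow>
      {\<omega> \<in> space M. F \<omega> = \<tau>} \<in> events \<and> prob {\<omega> \<in> space M. F \<omega> = \<tau>} = profile_weight p k a b \<tau>"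
  shows "prob {\<omega> \<in> space M. F \<omega> c \<le> l} =
    (\<Sum>\<tau> | \<tau> \<in> profiles k a b \<and> \<tau> c \<le> l. profile_weight p k a b \<tau>)"
proof -
  let ?\<Theta> = "{\<tau>. \<tau> \<in> profiles k a b \<and> \<tau> c \<le> l}"
  have "{\<omega> \<in> space M. F \<omega> c \<le> l} = (\<Union>\<tau>\<in>?\<Theta>. {\<omega> \<in> space M. F \<omega> = \<tau>})"
    using F by auto
  also have "prob \<dots> = (\<Sum>\<tau>\<in>?\<Theta>. prob {\<omega> \<in> space M. F \<omega> = \<tau>})"
    using law by (intro finite_measure_finite_Union)
      (auto simp: finite_profiles disjoint_family_on_def)
  also have "\<dots> = (\<Sum>\<tau>\<in>?\<Theta>. profile_weight p k a b \<tau>)"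
    using law by (intro sum.cong) auto
  finally show ?thesis .
qed

lemma box_subset_sites: "{1..a} \<times> {1..b} \<subseteq> sites"
  by (auto simp: sites_def)

text \<open>The event is a condition on each weight separately, so its probability factorises.\<close>

lemma passage_profile_law:
  assumes "iid_geometric N p W" and \<tau>: "\<tau> \<in> profiles k a b"
  shows "{\<omega> \<in> space N. passage_profile (\<lambda>s. W s \<omega>) k a b = \<tau>} \<in> sets N \<and>
    measure N {\<omega> \<in> space N. passage_profile (\<lambda>s. W s \<omega>) k a b = \<tau>} = profile_weight p k a b \<tau>"
proof -
  interpret prob_space N using assms by (simp add: iid_geometric_def)
  have W: "indep_vars (\<lambda>_. count_space UNIV) W sites"
    and geo: "\<And>s i. s \<in> sites \<Longrightarrow> prob {\<omega> \<in> space N. W s \<omega> = i} = p ^ i * (1 - p)"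
    using assms by (auto simp: iid_geometric_def)
  let ?B = "{1..a} \<times> {1..b}"
  let ?V = "\<lambda>x. {v. \<tau> x = min (Suc k) (base_level \<tau> x + v)}"
  have ev: "{\<omega> \<in> space N. passage_profile (\<lambda>s. W s \<omega>) k a b = \<tau>} =
      {\<omega> \<in> space N. \<forall>x\<in>?B. W (id x) \<omega> \<in> ?V x}"
    by (simp add: passage_profile_eq_iff[OF \<tau>])
  have "finite ?B" "id ` ?B \<subseteq> sites" using box_subset_sites by simp_all
  note all = indep_vars_prob_all[OF W this(1) inj_on_id this(2), of ?V]
  have cell: "prob {\<omega> \<in> space N. W (id x) \<omega> \<in> ?V x} = step_weight p k (base_level \<tau> x) (\<tau> x)"
    if "x \<in> ?B" for x
  proof -
    have x: "x \<in> sites" using that box_subset_sites by blast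
    then have "random_variable (count_space UNIV) (W x)"
      using W by (auto simp: indep_vars_def)
    from prob_clipped_geometric[OF this geo[OF x] base_level_le[OF \<tau>] profile_le[OF \<tau>]]
    show ?thesis by simp
  qed
  have "(\<Prod>x\<in>?B. prob {\<omega> \<in> space N. W (id x) \<omega> \<in> ?V x}) = profile_weight p k a b \<tau>"
    unfolding profile_weight_def by (rule prod.cong[OF refl cell])
  with all show ?thesis unfolding ev by metis
qed

lemma iid_bernoulli_prob:
  assumes "iid_bernoulli M p X" "0 < p" "p < 1" "s \<in> sites"
  shows "measure M {\<omega> \<in> space M. X s \<omega> = v} = (if v then p else 1 - p)"
proof -
  interpret prob_space M using assms by (simp add: iid_bernoulli_def)
  have rv: "random_variable (count_space UNIV) (X s)"
    and distr: "distr M (count_space UNIV) (X s) = measure_pmf (bernoulli_pmf p)"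
    using assms by (auto simp: iid_bernoulli_def indep_vars_def)
  have "measure (distr M (count_space UNIV) (X s)) {v} = prob (X s -` {v} \<inter> space M)"
    by (intro measure_distr rv) simp
  also have "X s -` {v} \<inter> space M = {\<omega> \<in> space M. X s \<omega> = v}" by auto
  finally show ?thesis
    using assms by (cases v) (simp_all add: distr measure_pmf_single)
qed

text \<open>
  A candidate that falls below an inherited value has probability 0 and weight 0. For any other,
  the event prescribes Bernoulli variables at distinct sites, and grouping them by the box
  site \<open>x\<close> collects the factor \<open>step_weight\<close>.
\<close>

lemma chain_profile_law:
  assumes bern: "iid_bernoulli M p X" and p: "0 < p" "p < 1" and h: "h \<noteq> (0, 0)"
    and \<tau>: "\<tau> \<in> profiles k a b"
  shows "{\<omega> \<in> space M. chain_profile h (random_set X \<omega>) k a b = \<tau>} \<in> sets M \<and>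
    measure M {\<omega> \<in> space M. chain_profile h (random_set X \<omega>) k a b = \<tau>} = profile_weight p k a b \<tau>"
proof -
  interpret prob_space M using bern by (simp add: iid_bernoulli_def)
  have X: "indep_vars (\<lambda>_. count_space UNIV) X sites"
    using bern by (simp add: iid_bernoulli_def)
  let ?B = "{1..a} \<times> {1..b}"
  let ?T = "\<lambda>x. {base_level \<tau> x..min k (\<tau> x)}"
  show ?thesis
  proof (cases "\<forall>x\<in>?B. base_level \<tau> x \<le> \<tau> x")
    case False
    then obtain x where x: "x \<in> ?B" "\<tau> x < base_level \<tau> x" by (auto simp: not_le)
    then have "profile_weight p k a b \<tau> = 0"
      unfolding profile_weight_def by (intro prod_zero) (auto simp: step_weight_def)
    moreover have "{\<omega> \<in> space M. chain_profile h (random_set X \<omega>) k a b = \<tau>} = {}"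
      using False by (auto simp: chain_profile_eq_iff[OF h \<tau>])
    ultimately show ?thesis by (simp only: measure_empty sets.empty_sets simp_thms)
  next
    case True
    let ?A = "SIGMA x:?B. ?T x"
    let ?V = "\<lambda>z. {v. v = (snd z < \<tau> (fst z))}"
    have inj: "inj_on (shifted h) ?A"
      using True by (intro inj_on_shifted[OF h]) blast
    have sites: "shifted h z \<in> sites" if "z \<in> ?A" for z
      using that by (auto simp: shifted_def sites_def)
    have ev: "{\<omega> \<in> space M. chain_profile h (random_set X \<omega>) k a b = \<tau>} =
        {\<omega> \<in> space M. \<forall>z\<in>?A. X (shifted h z) \<omega> \<in> ?V z}"
    proof (intro Collect_cong conj_cong refl)
      fix \<omega>
      have "shifted h z \<in> random_set X \<omega> \<longleftrightarrow> X (shifted h z) \<omega>" if "z \<in> ?A" for z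
        using sites[OF that] by (simp add: random_set_def)
      then show "chain_profile h (random_set X \<omega>) k a b = \<tau> \<longleftrightarrow>
          (\<forall>z\<in>?A. X (shifted h z) \<omega> \<in> ?V z)"
        unfolding chain_profile_eq_iff[OF h \<tau>] using True by fastforce
    qed
    have fin: "finite ?A" by simp
    have "shifted h ` ?A \<subseteq> sites" using sites by blast
    note all = indep_vars_prob_all[OF X fin inj this, of ?V]
    have "(\<Prod>z\<in>?A. prob {\<omega> \<in> space M. X (shifted h z) \<omega> \<in> ?V z}) =
        (\<Prod>z\<in>?A. if snd z < \<tau> (fst z) then p else 1 - p)"
      using iid_bernoulli_prob[OF bern p sites] by (intro prod.cong) simp_all
    also have "\<dots> = (\<Prod>x\<in>?B. \<Prod>t\<in>?T x. if t < \<tau> x then p else 1 - p)"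
      by (simp add: prod.Sigma case_prod_unfold)
    also have "\<dots> = profile_weight p k a b \<tau>"
      unfolding profile_weight_def
      using True profile_le[OF \<tau>] by (intro prod.cong prod_coins_eq_step_weight refl) auto
    finally show ?thesis
      using all unfolding ev by metis
  qed
qed

theorem theorem6:
  fixes M :: "'a measure" and N :: "'b measure"
    and \<Xi> :: "nat \<times> nat \<Rightarrow> 'a \<Rightarrow> bool" and \<Xi>' :: "nat \<times> nat \<Rightarrow> 'b \<Rightarrow> nat"
    and p :: real and h\<^sub>1 h\<^sub>2 m n k :: nat
  assumes "0 < p" and "p < 1"
    and "(h\<^sub>1, h\<^sub>2) \<noteq> (0, 0)"
    and "iid_bernoulli M p \<Xi>"
    and "iid_geometric N p \<Xi>'"
  shows "\<P>(\<omega> in M. longest_chain (h\<^sub>1, h\<^sub>2) (random_set \<Xi> \<omega>) m n \<le> k) =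
         \<P>(\<omega> in N. last_passage (\<lambda>s. \<Xi>' s \<omega>) (int m - int h\<^sub>1 * int k) (int n - int h\<^sub>2 * int k) \<le> k)"
proof -
  interpret M: prob_space M using assms(4) by (simp add: iid_bernoulli_def)
  interpret N: prob_space N using assms(5) by (simp add: iid_geometric_def)
  show ?thesis
  proof (cases "m \<le> h\<^sub>1 * k \<or> n \<le> h\<^sub>2 * k")
    case True
    then have "longest_chain (h\<^sub>1, h\<^sub>2) (random_set \<Xi> \<omega>) m n \<le> k" for \<omega>
      by (intro longest_chain_le_of_thin_box[OF assms(3)]) simp
    moreover have "int m - int h\<^sub>1 * int k \<le> 0 \<or> int n - int h\<^sub>2 * int k \<le> 0"
      using True by (metis diff_le_0_iff_le of_nat_le_iff of_nat_mult)
    then have "last_passage w (int m - int h\<^sub>1 * int k) (int n - int h\<^sub>2 * int k) \<le> k" for w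
      by (auto simp: last_passage_def)
    ultimately show ?thesis by (simp add: M.prob_space N.prob_space)
  next
    case False
    define a b where "a = m - h\<^sub>1 * k" and "b = n - h\<^sub>2 * k"
    have m: "m = a + h\<^sub>1 * k" "1 \<le> a" and n: "n = b + h\<^sub>2 * k" "1 \<le> b"
      using False by (auto simp: a_def b_def)
    have "longest_chain (h\<^sub>1, h\<^sub>2) S m n \<le> k \<longleftrightarrow> chain_profile (h\<^sub>1, h\<^sub>2) S k a b (a, b) \<le> k" for S
      using less_chain_profile_iff[OF assms(3), of a a b b k S k] m n by auto
    moreover have "last_passage w (int m - int h\<^sub>1 * int k) (int n - int h\<^sub>2 * int k) \<le> k \<longleftrightarrow>
        passage_profile w k a b (a, b) \<le> k" for w
      using m n by (auto simp: passage_profile_def)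
    ultimately show ?thesis
      using M.prob_profile_le[OF chain_profile_in_profiles chain_profile_law[OF assms(4,1,2,3)]]
        N.prob_profile_le[OF passage_profile_in_profiles passage_profile_law[OF assms(5)]]
      by simp
  qed
qed

end
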